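(* Let $n\ge2$ be even and $0\le q\le p\le n$. On the strip of squares $\mathcal G_{2,n}$ on the torus, the number $b_{n,p,q}$ of distinct perfect matchings obtained from the highest weight matching by $p-q$ moves $\mathrm d_a$ and $q$ moves $\mathrm d_b$ equals $$b_{n,p,q}=\frac{1}{q!\,(p-q)!}\,n\,\frac{(n-q-1)!}{(n-q-p)!}=\frac{n}{n-q}\binom pq\binom{n-q}{p},$$ where the expressions are read as $0$ when $q>n-p$. Consequently the total number of perfect matchings of $\mathcal G_{2,n}$ with weight $(n_z,n_w)=(n/2-p,0)$ is $$b_{n,p}=\sum_{q=0}^{p}\frac{n\,(n-q-1)!}{q!\,(p-q)!\,(n-q-p)!},$$ where terms with $q>n-p$ are read as $0$.
   Context: Strip of squares. For even $n\ge2$, the strip of squares $\mathcal G_{2,n}$ on the torus is the multigraph with $2n$ nodes $(r,j)$, $r\in\mathbb Z/2$ (row; $r=0$ bottom, $r=1$ top), $j\in\mathbb Z/n$ (column). Node $(r,j)$ is black if $r+j$ is even and white otherwise, so there are $n$ black nodes, one in each column. There are $4n$ distinct edges (parallel edges count as different): horizontal edges $h_{r,j}$ joining $(r,j)$ and $(r,j+1)$, and vertical edges $v_{r,j}$ joining $(r,j)$ and $(r+1,j)$, where $v_{r,j}$ is thought of as going upwards from $(r,j)$; thus $v_{0,j}$ is internal and $v_{1,j}$ crosses the cycle $z$ of the torus. The up edge of a node $(r,j)$ is $v_{r,j}$ and its down edge is $v_{r+1,j}$ (indices mod 2). Weights. A perfect matching is a set of edges touching each node exactly once. Edges are directed from black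 to white. The $z$-weight $n_z$ of a matching $M$ is the sum over edges $v_{1,j}\in M$ of $+1$ if $(1,j)$ is black and $-1$ if $(1,j)$ is white. The $w$-weight $n_w$ of $M$ is the sum over edges $h_{r,n-1}\in M$ (those crossing the cycle $w$) of $+1$ if $(r,n-1)$ is black and $-1$ if $(r,n-1)$ is white. The weight of $M$ is the pair $(n_z,n_w)$. Moves. The highest weight matching is the one in which every black node is matched along its up edge (its weight is $(n/2,0)$). A move $\mathrm d_a$ is applied to a column whose black node is matched along its up edge, and replaces that edge by the down edge of the black node. A move $\mathrm d_b$ is applied to a pair of neighbouring columns $j,j+1$ (with $j\in\mathbb Z/n$; for $n=2$ the choices $j=0$ and $j=1$ are different) whose two black nodes are both matched along their up edges, and replaces these two vertical edges by $h_{0,j}$ and $h_{1,j}$. Each move lowers $n_z$ by one. The moves may be performed in any order. *)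

theory Defs
  imports Complex_Main
begin

text \<open>
  Rows and columns, i.e. elements of \<open>\<int>/2\<close> and \<open>\<int>/n\<close>, are represented by their
  residues in \<open>{0, 1}\<close> and \<open>{0, \<dots>, n - 1}\<close>. Edges are named rather than identified with
  their end points, because the graph has parallel edges.
\<close>

type_synonym node = "nat \<times> nat"

datatype edge = Horiz nat nat | Vert nat nat

definition nodes :: "nat \<Rightarrow> node set" where
  "nodes n = {0..<2} \<times> {0..<n}"

definition black :: "node \<Rightarrow> bool" where
  "black x \<longleftrightarrow> even (fst x + snd x)"

definition edges :: "nat \<Rightarrow> edge set" where
  "edges n = {Horiz r j | r j. (r, j) \<in> nodes n} \<union> {Vert r j | r j. (r, j) \<in> nodes n}"

fun ends :: "nat \<Rightarrow> edge \<Rightarrow> node set" where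
  "ends n (Horiz r j) = {(r, j), (r, (j + 1) mod n)}"
| "ends n (Vert r j) = {(r, j), ((r + 1) mod 2, j)}"

definition up_edge :: "node \<Rightarrow> edge" where
  "up_edge x = Vert (fst x) (snd x)"

definition down_edge :: "node \<Rightarrow> edge" where
  "down_edge x = Vert ((fst x + 1) mod 2) (snd x)"

definition perfect_matching :: "nat \<Rightarrow> edge set \<Rightarrow> bool" where
  "perfect_matching n M \<longleftrightarrow>
     M \<subseteq> edges n \<and> (\<forall>x\<in>nodes n. \<exists>!e. e \<in> M \<and> x \<in> ends n e)"

definition z_weight :: "nat \<Rightarrow> edge set \<Rightarrow> int" where
  "z_weight n M = (\<Sum>j | j < n \<and> Vert 1 j \<in> M. if black (1, j) then 1 else - 1)"

definition w_weight :: "nat \<Rightarrow> edge set \<Rightarrow> int" where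
  "w_weight n M =
     (\<Sum>r | r < 2 \<and> Horiz r (n - 1) \<in> M. if black (r, n - 1) then 1 else - 1)"

definition weight :: "nat \<Rightarrow> edge set \<Rightarrow> int \<times> int" where
  "weight n M = (z_weight n M, w_weight n M)"

definition highest_matching :: "nat \<Rightarrow> edge set" where
  "highest_matching n = {up_edge x | x. x \<in> nodes n \<and> black x}"

definition move_a :: "nat \<Rightarrow> edge set \<Rightarrow> edge set \<Rightarrow> bool" where
  "move_a n M M' \<longleftrightarrow>
     (\<exists>x. x \<in> nodes n \<and> black x \<and> up_edge x \<in> M \<and>
          M' = (M - {up_edge x}) \<union> {down_edge x})"

definition move_b :: "nat \<Rightarrow> edge set \<Rightarrow> edge set \<Rightarrow> bool" where
  "move_b n M M' \<longleftrightarrow>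
     (\<exists>j x y. x \<in> nodes n \<and> black x \<and> snd x = j \<and>
              y \<in> nodes n \<and> black y \<and> snd y = (j + 1) mod n \<and>
              up_edge x \<in> M \<and> up_edge y \<in> M \<and>
              M' = (M - {up_edge x, up_edge y}) \<union> {Horiz 0 j, Horiz 1 j})"

text \<open>
  \<open>obtained n a b M\<close>: \<open>M\<close> arises from the highest weight matching by \<open>a\<close> moves of the first
  kind and \<open>b\<close> moves of the second kind, in some order.
\<close>

inductive obtained :: "nat \<Rightarrow> nat \<Rightarrow> nat \<Rightarrow> edge set \<Rightarrow> bool" for n :: nat where
  start: "obtained n 0 0 (highest_matching n)"
| step_a: "obtained n a b M \<Longrightarrow> move_a n M M' \<Longrightarrow> obtained n (Suc a) b M'"
| step_b: "obtained n a b M \<Longrightarrow> move_b n M M' \<Longrightarrow> obtained n a (Suc b) M'"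

definition num_obtained :: "nat \<Rightarrow> nat \<Rightarrow> nat \<Rightarrow> nat" where
  "num_obtained n p q = card {M. perfect_matching n M \<and> obtained n (p - q) q M}"

definition num_weight :: "nat \<Rightarrow> nat \<Rightarrow> nat" where
  "num_weight n p =
     card {M. perfect_matching n M \<and> weight n M = (int (n div 2) - int p, 0)}"

end

theory Submission
  imports Defs
begin

text \<open>
  A matching with \<open>n\<^sub>w = 0\<close> is determined by the set \<open>S\<close> of columns \<open>j\<close> such that both rows use the
  horizontal edge from \<open>j\<close> to \<open>j + 1\<close>, and the set \<open>D\<close> of vertically matched columns whose black
  node uses its down edge: the only other matchings are the two brick patterns, where the two rows
  alternate all around the torus, and these have \<open>n\<^sub>w = 1\<close> and \<open>n\<^sub>w = - 1\<close>. A move of the first kind adds a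
  column to \<open>D\<close> and a move of the second kind adds one to \<open>S\<close>, so the task is to count pairs with
  \<open>card S = q\<close> and \<open>card D = p - q\<close>. There are \<open>n / (n - q) * (n - q choose q)\<close> ways to place \<open>q\<close> disjoint
  dominoes on a cycle of length \<open>n\<close>, and then \<open>n - 2 * q choose p - q\<close> choices of \<open>D\<close>.
\<close>

section \<open>The cyclic successor on columns\<close>

definition nxt :: "nat \<Rightarrow> nat \<Rightarrow> nat" where
  "nxt n j = (j + 1) mod n"

lemma nxt_eq: "j < n \<Longrightarrow> nxt n j = (if Suc j = n then 0 else Suc j)"
  by (auto simp: nxt_def)

lemma nxt_less: "j < n \<Longrightarrow> nxt n j < n"
  by (auto simp: nxt_eq)

lemma inj_on_nxt: "inj_on (nxt n) {..<n}"
  by (auto simp: inj_on_def nxt_eq split: if_splits)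

lemma nxt_inject: "j < n \<Longrightarrow> k < n \<Longrightarrow> nxt n j = nxt n k \<longleftrightarrow> j = k"
  using inj_on_nxt[of n] by (auto simp: inj_on_def)

lemma nxt_neq: "j < n \<Longrightarrow> n \<ge> 2 \<Longrightarrow> nxt n j \<noteq> j"
  by (auto simp: nxt_eq)

section \<open>Encoding matchings by sets of columns\<close>

text \<open>An element \<open>j\<close> stands for a domino on the columns \<open>j\<close> and
  \<open>nxt n j\<close>. As \<open>nxt n\<close> is injective on columns, distinct dominoes can
  meet only when one starts where the other ends, so the condition expresses disjointness.\<close>

definition cyclically_sparse :: "nat \<Rightarrow> nat set \<Rightarrow> bool" where
  "cyclically_sparse n S \<longleftrightarrow> S \<subseteq> {..<n} \<and> (\<forall>j\<in>S. nxt n j \<notin> S)"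

definition covered :: "nat \<Rightarrow> nat set \<Rightarrow> nat set" where
  "covered n S = S \<union> nxt n ` S"

definition config :: "nat \<Rightarrow> nat set \<Rightarrow> nat set \<Rightarrow> bool" where
  "config n S D \<longleftrightarrow> cyclically_sparse n S \<and> D \<subseteq> {..<n} - covered n S"

text \<open>\<open>Vert r j\<close> is the up edge of the black node of column \<open>j\<close> exactly when \<open>r + j\<close> is even.\<close>

definition matching :: "nat \<Rightarrow> nat set \<Rightarrow> nat set \<Rightarrow> edge set" where
  "matching n S D =
     {Vert r j | r j. r < 2 \<and> j < n \<and> j \<notin> covered n S \<and> (j \<in> D \<longleftrightarrow> odd (r + j))} \<union>
     {Horiz r j | r j. r < 2 \<and> j \<in> S}"

lemma Vert_in_matching [simp]:
  "Vert r j \<in> matching n S D \<longleftrightarrow>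
     r < 2 \<and> j < n \<and> j \<notin> covered n S \<and> (j \<in> D \<longleftrightarrow> odd (r + j))"
  by (auto simp: matching_def)

lemma Horiz_in_matching [simp]: "Horiz r j \<in> matching n S D \<longleftrightarrow> r < 2 \<and> j \<in> S"
  by (auto simp: matching_def)

lemma covered_subset: "S \<subseteq> {..<n} \<Longrightarrow> covered n S \<subseteq> {..<n}"
  by (auto simp: covered_def nxt_less)

lemma covered_insert: "covered n (insert j S) = insert j (insert (nxt n j) (covered n S))"
  by (auto simp: covered_def)

lemma finite_config: "config n S D \<Longrightarrow> finite S \<and> finite D"
  by (auto simp: config_def cyclically_sparse_def intro: finite_subset)

lemma edge_set_eqI:
  assumes "\<And>r j. Vert r j \<in> A \<longleftrightarrow> Vert r j \<in> B" "\<And>r j. Horiz r j \<in> A \<longleftrightarrow> Horiz r j \<in> B"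
  shows "A = B"
proof (rule set_eqI)
  fix e show "e \<in> A \<longleftrightarrow> e \<in> B" using assms by (cases e) auto
qed

text \<open>Horizontal edges in row 0 recover \<open>S\<close>. In an uncovered column,
  \<open>Vert (j mod 2) j\<close> is the up edge of the black node, so its presence decides whether
  \<open>j\<close> is in \<open>D\<close>.\<close>

lemma matching_inject:
  assumes "config n S D" "config n S' D'" "matching n S D = matching n S' D'"
  shows "S = S'" "D = D'"
proof -
  have "j \<in> S \<longleftrightarrow> j \<in> S'" for j
    using Horiz_in_matching[of 0 j n S D] Horiz_in_matching[of 0 j n S' D'] assms(3) by simp
  then show S: "S = S'" by blast
  have "j \<in> D \<longleftrightarrow> j \<in> D'" for j
  proof (cases "j < n \<and> j \<notin> covered n S")
    case True
    have "Vert (j mod 2) j \<in> matching n S D \<longleftrightarrow> Vert (j mod 2) j \<in> matching n S' D'"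
      by (simp only: assms(3))
    then show ?thesis using True S by simp
  next
    case False
    then show ?thesis using assms S by (auto simp: config_def)
  qed
  then show "D = D'" by blast
qed

section \<open>The moves on configurations\<close>

lemma black_node_iff:
  "x \<in> nodes n \<and> black x \<and> snd x = j \<longleftrightarrow> j < n \<and> x = (j mod 2, j)"
  by (cases x) (auto simp: nodes_def black_def, presburger+)

lemma highest_matching_eq: "highest_matching n = matching n {} {}"
  by (rule edge_set_eqI)
    (auto simp: highest_matching_def up_edge_def nodes_def black_def covered_def)

lemma move_a_matching:
  "move_a n (matching n S D) M' \<longleftrightarrow>
     (\<exists>j. j < n \<and> j \<notin> covered n S \<and> j \<notin> D \<and> M' = matching n S (insert j D))"
proof -
  have *: "(matching n S D - {Vert (j mod 2) j}) \<union> {Vert ((j mod 2 + 1) mod 2) j}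
      = matching n S (insert j D)" if "j < n" "j \<notin> covered n S" "j \<notin> D" for j
    using that by (intro edge_set_eqI) (auto, presburger+)
  have "move_a n (matching n S D) M' \<longleftrightarrow>
     (\<exists>j. j < n \<and> Vert (j mod 2) j \<in> matching n S D \<and>
       M' = (matching n S D - {Vert (j mod 2) j}) \<union> {Vert ((j mod 2 + 1) mod 2) j})"
    unfolding move_a_def up_edge_def down_edge_def using black_node_iff[of _ n]
    by (metis fst_conv snd_conv)
  also have "\<dots> \<longleftrightarrow> (\<exists>j. j < n \<and> j \<notin> covered n S \<and> j \<notin> D \<and> M' = matching n S (insert j D))"
  proof -
    have "Vert (j mod 2) j \<in> matching n S D \<longleftrightarrow> j < n \<and> j \<notin> covered n S \<and> j \<notin> D" for j
      by auto
    then show ?thesis using * by metis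
  qed
  finally show ?thesis .
qed

text \<open>Two up edges of black nodes in neighbouring columns mean that both columns are uncovered
  and outside \<open>D\<close>. The horizontal pair then turns them into the new domino starting at
  \<open>j\<close>.\<close>

lemma move_b_matching:
  assumes "S \<subseteq> {..<n}" "n \<ge> 2"
  shows "move_b n (matching n S D) M' \<longleftrightarrow>
     (\<exists>j. j < n \<and> j \<notin> covered n S \<and> nxt n j \<notin> covered n S \<and> j \<notin> D \<and> nxt n j \<notin> D \<and>
        M' = matching n (insert j S) D)"
proof -
  have *: "(matching n S D - {Vert (j mod 2) j, Vert (nxt n j mod 2) (nxt n j)}) \<union> {Horiz 0 j, Horiz 1 j}
      = matching n (insert j S) D"
    if "j < n" "j \<notin> covered n S" "j \<notin> D" "nxt n j \<notin> covered n S" "nxt n j \<notin> D" for j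
    using that by (intro edge_set_eqI) (auto simp: covered_insert, presburger+)
  have "move_b n (matching n S D) M' \<longleftrightarrow>
     (\<exists>j. j < n \<and> Vert (j mod 2) j \<in> matching n S D \<and>
       Vert (nxt n j mod 2) (nxt n j) \<in> matching n S D \<and>
       M' = (matching n S D - {Vert (j mod 2) j, Vert (nxt n j mod 2) (nxt n j)}) \<union> {Horiz 0 j, Horiz 1 j})"
    (is "_ \<longleftrightarrow> (\<exists>j. ?P j)")
  proof
    assume "move_b n (matching n S D) M'"
    then obtain j x y where x: "x \<in> nodes n \<and> black x \<and> snd x = j"
      and y: "y \<in> nodes n \<and> black y \<and> snd y = nxt n j"
      and m: "up_edge x \<in> matching n S D" "up_edge y \<in> matching n S D"
        "M' = (matching n S D - {up_edge x, up_edge y}) \<union> {Horiz 0 j, Horiz 1 j}"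
      unfolding move_b_def nxt_def by blast
    have "j < n" "x = (j mod 2, j)" "y = (nxt n j mod 2, nxt n j)"
      using x y unfolding black_node_iff by blast+
    then have "?P j" using m by (simp only: up_edge_def fst_conv snd_conv)
    then show "\<exists>j. ?P j" ..
  next
    assume "\<exists>j. ?P j"
    then obtain j where j: "?P j" by blast
    have "(j mod 2, j) \<in> nodes n" "black (j mod 2, j)"
      "(nxt n j mod 2, nxt n j) \<in> nodes n" "black (nxt n j mod 2, nxt n j)"
      using j nxt_less[of j n] by (auto simp: nodes_def black_def)
    then show "move_b n (matching n S D) M'"
      using j unfolding move_b_def up_edge_def nxt_def[symmetric] by (metis fst_conv snd_conv)
  qed
  also have "\<dots> \<longleftrightarrow> (\<exists>j. j < n \<and> j \<notin> covered n S \<and> nxt n j \<notin> covered n S \<and> j \<notin> D \<and> nxt n j \<notin> D \<and>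
        M' = matching n (insert j S) D)"
  proof -
    have "Vert (j mod 2) j \<in> matching n S D \<longleftrightarrow> j < n \<and> j \<notin> covered n S \<and> j \<notin> D" for j
      by auto
    then show ?thesis using * nxt_less[of _ n] by metis
  qed
  finally show ?thesis .
qed

text \<open>The condition on \<open>j\<close> is the one under which a move of the second kind
  applies. Being an equivalence, it shows both that such moves preserve configurations and that a
  domino can be taken off and put back.\<close>

lemma config_insert_pair_iff:
  assumes "n \<ge> 2" "j \<notin> S"
  shows "config n (insert j S) D \<longleftrightarrow>
    config n S D \<and> j < n \<and> j \<notin> covered n S \<and> nxt n j \<notin> covered n S \<and> j \<notin> D \<and> nxt n j \<notin> D"
  using assms nxt_neq[of j n] nxt_inject[of j n]
  by (auto simp: config_def cyclically_sparse_def covered_def subset_iff)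

lemma obtained_matching:
  assumes "n \<ge> 2" "obtained n a b M"
  shows "\<exists>S D. config n S D \<and> card D = a \<and> card S = b \<and> M = matching n S D"
  using assms(2)
proof induction
  case start
  have "config n {} {}" by (simp add: config_def cyclically_sparse_def)
  then show ?case by (metis card.empty highest_matching_eq)
next
  case (step_a a b M M')
  then obtain S D where SD: "config n S D" "card D = a" "card S = b" "M = matching n S D"
    by blast
  then obtain j where j: "j < n" "j \<notin> covered n S" "j \<notin> D" "M' = matching n S (insert j D)"
    using step_a.hyps(2) unfolding SD(4) move_a_matching by blast
  note * = SD j
  then have "config n S (insert j D)" "card (insert j D) = Suc a"
    using finite_config[of n S D] by (auto simp: config_def)
  then show ?case using * by blast
next
  case (step_b a b M M')
  then obtain S D where *: "config n S D" "card D = a" "card S = b" "M = matching n S D"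
    by blast
  then have "S \<subseteq> {..<n}" by (simp add: config_def cyclically_sparse_def)
  then obtain j where j: "j < n" "j \<notin> covered n S" "nxt n j \<notin> covered n S" "j \<notin> D" "nxt n j \<notin> D"
      "M' = matching n (insert j S) D"
    using step_b.hyps(2) unfolding *(4) move_b_matching[OF \<open>S \<subseteq> {..<n}\<close> assms(1)] by blast
  then have "j \<notin> S" by (simp add: covered_def)
  then have "config n (insert j S) D" "card (insert j S) = Suc b"
    using finite_config[of n S D] config_insert_pair_iff[of n j S D] j * assms(1) by auto
  then show ?case using * j by blast
qed

text \<open>One suitable order of moves is enough: all dominoes are placed while \<open>D\<close> is
  still empty, then the columns of \<open>D\<close> are switched one at a time.\<close>

lemma matching_obtained:
  assumes "n \<ge> 2" "config n S D"
  shows "obtained n (card D) (card S) (matching n S D)"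
proof -
  have S: "obtained n 0 (card S) (matching n S {})" if "finite S" "config n S {}" for S
    using that
  proof (induction S)
    case empty
    then show ?case using obtained.start[of n] by (simp add: highest_matching_eq)
  next
    case (insert j S)
    then have c: "config n S {}" "j < n" "j \<notin> covered n S" "nxt n j \<notin> covered n S"
      using config_insert_pair_iff[of n j S "{}"] assms(1) by auto
    then have "S \<subseteq> {..<n}" by (simp add: config_def cyclically_sparse_def)
    then have "move_b n (matching n S {}) (matching n (insert j S) {})"
      using c assms(1) by (subst move_b_matching) auto
    then show ?case using insert c obtained.step_b[of n] by simp
  qed
  have "obtained n (card D) (card S) (matching n S D)" if "finite D" "config n S D" for D
    using that
  proof (induction D)
    case empty
    then show ?case using S finite_config by simp
  next
    case (insert j D)
    then have "config n S D" "move_a n (matching n S D) (matching n S (insert j D))"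
      by (auto simp: config_def move_a_matching)
    then show ?case using insert obtained.step_a[of n] by simp
  qed
  then show ?thesis using assms finite_config by blast
qed

section \<open>Configurations yield perfect matchings\<close>

text \<open>Both vertical edges of a column meet both of its nodes, hence the free \<open>s\<close>.
  The edge from the left is given by a preimage under \<open>nxt n\<close>, which avoids a cyclic
  predecessor.\<close>

lemma mem_ends_iff:
  assumes "e \<in> edges n" "r < 2" "j < n"
  shows "(r, j) \<in> ends n e \<longleftrightarrow>
    (\<exists>s<2. e = Vert s j) \<or> e = Horiz r j \<or> (\<exists>k<n. e = Horiz r k \<and> nxt n k = j)"
  using assms by (cases e) (auto simp: edges_def nodes_def nxt_def, presburger+)

lemma matching_subset_edges: "S \<subseteq> {..<n} \<Longrightarrow> matching n S D \<subseteq> edges n"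
  by (auto simp: matching_def edges_def nodes_def)

lemma perfect_matching_matching:
  assumes "n \<ge> 2" "config n S D"
  shows "perfect_matching n (matching n S D)"
proof -
  let ?M = "matching n S D"
  have S: "S \<subseteq> {..<n}" and sp: "\<And>j. j \<in> S \<Longrightarrow> nxt n j \<notin> S"
    using assms(2) by (auto simp: config_def cyclically_sparse_def)
  have sub: "?M \<subseteq> edges n" by (rule matching_subset_edges[OF S])
  have "\<exists>!e. e \<in> ?M \<and> (r, j) \<in> ends n e" if rj: "r < 2" "j < n" for r j
  proof -
    have iff: "e \<in> ?M \<and> (r, j) \<in> ends n e \<longleftrightarrow> e \<in> ?M \<and>
        ((\<exists>s<2. e = Vert s j) \<or> e = Horiz r j \<or> (\<exists>k<n. e = Horiz r k \<and> nxt n k = j))" for e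
      using mem_ends_iff[OF _ rj] sub by blast
    consider "j \<in> S" | k where "k \<in> S" "j = nxt n k" | "j \<notin> covered n S"
      by (auto simp: covered_def)
    then show ?thesis
    proof cases
      case 1
      show ?thesis unfolding iff
        by (rule ex1I[of _ "Horiz r j"]) (use 1 rj sp in \<open>auto simp: covered_def\<close>)
    next
      case 2
      have "k < n" using 2 S by auto
      show ?thesis unfolding iff
        by (rule ex1I[of _ "Horiz r k"])
          (use 2 S rj sp nxt_inject[OF _ \<open>k < n\<close>] in \<open>auto simp: covered_def\<close>)
    next
      case 3
      \<comment> \<open>\<open>s\<close> is the row of the black node when \<open>j\<close> is
        outside \<open>D\<close> and the other row otherwise, the one row with the parity that
        \<open>matching\<close> demands.\<close>
      define s where "s = (if j \<in> D then (j + 1) mod 2 else j mod 2)"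
      have s: "s < 2" "odd (s + j) \<longleftrightarrow> j \<in> D" by (auto simp: s_def)
      have u: "t = s" if "t < 2" "odd (t + j) \<longleftrightarrow> j \<in> D" for t
        using s that by (auto simp: less_2_cases_iff)
      show ?thesis unfolding iff
      proof (rule ex1I[of _ "Vert s j"])
        show "Vert s j \<in> ?M \<and> ((\<exists>t<2. Vert s j = Vert t j) \<or> Vert s j = Horiz r j \<or>
            (\<exists>k<n. Vert s j = Horiz r k \<and> nxt n k = j))"
          using 3 rj s by simp
      next
        fix e assume e: "e \<in> ?M \<and>
            ((\<exists>t<2. e = Vert t j) \<or> e = Horiz r j \<or> (\<exists>k<n. e = Horiz r k \<and> nxt n k = j))"
        then have "\<exists>t<2. e = Vert t j" using 3 unfolding covered_def by auto
        then show "e = Vert s j" using e u by force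
      qed
    qed
  qed
  then show ?thesis using sub by (auto simp: perfect_matching_def nodes_def)
qed

section \<open>Perfect matchings with zero horizontal weight\<close>

lemma w_weight_eq:
  "w_weight n M = (if Horiz 0 (n - 1) \<in> M then if even (n - 1) then 1 else - 1 else 0) +
     (if Horiz 1 (n - 1) \<in> M then if odd (n - 1) then 1 else - 1 else 0)"
proof -
  have "{r. r < 2 \<and> Horiz r (n - 1) \<in> M} =
      (if Horiz 0 (n - 1) \<in> M then {0} else {}) \<union> (if Horiz 1 (n - 1) \<in> M then {1} else {})"
    by (auto simp: less_2_cases_iff intro!: gr0I)
  then show ?thesis by (auto simp: w_weight_def black_def)
qed

text \<open>The two nodes in column \<open>n - 1\<close> have opposite colours, so the possible
  contributions are 1 and -1 and cancel exactly when both edges are present or both absent.\<close>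

lemma w_weight_eq_0_iff:
  "w_weight n M = 0 \<longleftrightarrow> (Horiz 0 (n - 1) \<in> M \<longleftrightarrow> Horiz 1 (n - 1) \<in> M)"
  by (auto simp: w_weight_eq)

lemma perfect_matching_at:
  assumes "perfect_matching n M" "r < 2" "j < n"
  shows "\<exists>!e. e \<in> M \<and>
    ((\<exists>s<2. e = Vert s j) \<or> e = Horiz r j \<or> (\<exists>k<n. e = Horiz r k \<and> nxt n k = j))"
proof -
  have "M \<subseteq> edges n" "\<exists>!e. e \<in> M \<and> (r, j) \<in> ends n e"
    using assms by (auto simp: perfect_matching_def nodes_def)
  then show ?thesis using mem_ends_iff[OF _ assms(2,3)]
    by (smt (verit, best) subsetD)
qed

lemma ex1D: "\<exists>!x. P x \<Longrightarrow> P a \<Longrightarrow> P b \<Longrightarrow> a = b"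
  by blast

lemma perfect_matching_rows_agree:
  assumes n: "n \<ge> 2" and M: "perfect_matching n M" and w: "w_weight n M = 0" and "j < n"
  shows "Horiz 0 j \<in> M \<longleftrightarrow> Horiz 1 j \<in> M"
proof -
  \<comment> \<open>If only one row uses the edge to the right of a column, the other node of that column must be
    matched to its left, so the rows also disagree at the previous column. The contrapositive is
    used, starting from column \<open>n - 1\<close>, where \<open>n\<^sub>w = 0\<close> says that the rows agree.\<close>
  have step: "Horiz 0 (nxt n j) \<in> M \<longleftrightarrow> Horiz 1 (nxt n j) \<in> M"
    if j: "j < n" and eq: "Horiz 0 j \<in> M \<longleftrightarrow> Horiz 1 j \<in> M" for j
  proof -
    note at = perfect_matching_at[OF M _ nxt_less[OF j]]
    have imp: "Horiz r' (nxt n j) \<in> M" if r: "r < 2" "r' < 2" "Horiz r (nxt n j) \<in> M"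
      and eq': "Horiz r j \<in> M \<longleftrightarrow> Horiz r' j \<in> M" for r r'
    proof -
      obtain e where e: "e \<in> M"
        "(\<exists>s<2. e = Vert s (nxt n j)) \<or> e = Horiz r' (nxt n j) \<or> (\<exists>k<n. e = Horiz r' k \<and> nxt n k = nxt n j)"
        using at[OF r(2)] by blast
      \<comment> \<open>A vertical edge in this column also touches the node in row
        \<open>r\<close>, which is already matched to its right.\<close>
      have "e \<noteq> Vert s (nxt n j)" if "s < 2" for s
      proof
        assume "e = Vert s (nxt n j)"
        then have "Vert s (nxt n j) = Horiz r (nxt n j)"
          using ex1D[OF at[OF r(1)]] r(3) e(1) that by blast
        then show False by simp
      qed
      moreover have "e \<noteq> Horiz r' j"
      proof
        assume "e = Horiz r' j"
        then have "Horiz r j = Horiz r (nxt n j)"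
          using ex1D[OF at[OF r(1)]] r(3) e(1) eq' j by blast
        then show False using nxt_neq[OF j n] by simp
      qed
      ultimately show ?thesis using e nxt_inject[OF _ j] by blast
    qed
    show ?thesis using imp[of 0 1] imp[of 1 0] eq by auto
  qed
  have last: "Horiz 0 (n - 1) \<in> M \<longleftrightarrow> Horiz 1 (n - 1) \<in> M"
    using w by (simp add: w_weight_eq_0_iff)
  show ?thesis using \<open>j < n\<close>
  proof (induction j)
    case 0
    then show ?case using step[of "n - 1"] last n by (simp add: nxt_eq)
  next
    case (Suc j)
    then show ?case using step[of j] by (simp add: nxt_eq)
  qed
qed

text \<open>Agreement of the rows lets row 0 alone define \<open>S\<close>. At the node in row 0,
  uniqueness then forbids vertical edges in covered columns, while existence and uniqueness give
  exactly one in every other column.\<close>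

lemma perfect_matching_eq_matching:
  assumes n: "n \<ge> 2" and M: "perfect_matching n M" and w: "w_weight n M = 0"
  obtains S D where "config n S D" "M = matching n S D"
proof -
  define S where "S = {j. j < n \<and> Horiz 0 j \<in> M}"
  \<comment> \<open>\<open>(j + 1) mod 2\<close> is the row of the white node, whose up edge is the
    down edge of the black node.\<close>
  define D where "D = {j. j < n \<and> Vert ((j + 1) mod 2) j \<in> M}"
  have H: "Horiz r j \<in> M \<longleftrightarrow> j \<in> S" if "r < 2" "j < n" for r j
    using perfect_matching_rows_agree[OF n M w] that less_2_cases[of r] by (auto simp: S_def)
  note at = perfect_matching_at[OF M]
  have edges: "M \<subseteq> edges n" using M by (simp add: perfect_matching_def)
  have sp: "nxt n j \<notin> S" if "j \<in> S" for j
  proof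
    assume "nxt n j \<in> S"
    then have "Horiz 0 (nxt n j) \<in> M" "Horiz 0 j \<in> M" "j < n" using that by (auto simp: S_def)
    then show False using at[of 0 "nxt n j"] nxt_less nxt_neq n
      by (metis edge.inject(1) pos2)
  qed
  have V: "Vert s j \<notin> M" if sj: "s < 2" "j \<in> covered n S" for s j
  proof
    assume v: "Vert s j \<in> M"
    have jn: "j < n" using that by (auto simp: covered_def S_def nxt_less)
    obtain k where "k < n" "Horiz 0 k \<in> M" "k = j \<or> nxt n k = j"
      using sj(2) unfolding covered_def S_def by blast
    then show False using at[of 0 j] v \<open>s < 2\<close> jn
      by (metis edge.distinct(1) pos2)
  qed
  have V1: "\<exists>s<2. Vert s j \<in> M" if jc: "j < n" "j \<notin> covered n S" for j
  proof -
    obtain e where e: "e \<in> M"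
        "(\<exists>s<2. e = Vert s j) \<or> e = Horiz 0 j \<or> (\<exists>k<n. e = Horiz 0 k \<and> nxt n k = j)"
      using at[OF pos2 jc(1)] by blast
    then show ?thesis using jc by (auto simp: covered_def S_def)
  qed
  have V2: "s = t" if "Vert s j \<in> M" "Vert t j \<in> M" for s t j
  proof -
    have "s < 2" "t < 2" "j < n" using that edges by (auto simp: edges_def nodes_def)
    then show ?thesis using at[of 0 j] that by (metis edge.inject(2) pos2)
  qed
  have "config n S D"
    using sp V by (auto simp: config_def cyclically_sparse_def S_def D_def)
  moreover have "M = matching n S D"
  proof (rule edge_set_eqI)
    fix r j
    show "Horiz r j \<in> M \<longleftrightarrow> Horiz r j \<in> matching n S D"
      using H[of r j] edges by (auto simp: edges_def nodes_def S_def)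
    show "Vert r j \<in> M \<longleftrightarrow> Vert r j \<in> matching n S D"
    proof (cases "r < 2 \<and> j < n \<and> j \<notin> covered n S")
      case False
      then show ?thesis using edges V[of r j] by (auto simp: edges_def nodes_def)
    next
      case True
      then obtain s where s: "s < 2" "Vert s j \<in> M" using V1 by blast
      have 1: "Vert r j \<in> M \<longleftrightarrow> r = s" using V2 s by blast
      have 2: "j \<in> D \<longleftrightarrow> s = (j + 1) mod 2" using V2 s True by (auto simp: D_def)
      show ?thesis unfolding Vert_in_matching 1 2 using s True
        by (auto simp: less_2_cases_iff)
    qed
  qed
  ultimately show ?thesis using that by blast
qed

section \<open>Weights of configurations\<close>

text \<open>Sparsity makes \<open>S\<close> disjoint from its shift, and \<open>nxt n\<close> is
  injective. The summand is kept general: a constant gives the number of covered columns, a parity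
  indicator their share in the z-weight.\<close>

lemma sum_covered:
  assumes "n \<ge> 2" "cyclically_sparse n S"
  shows "sum f (covered n S) = (\<Sum>j\<in>S. f j + f (nxt n j))"
proof -
  have S: "S \<subseteq> {..<n}" "finite S" using assms(2) finite_subset
    by (auto simp: cyclically_sparse_def)
  have inj: "inj_on (nxt n) S" using inj_on_nxt S(1) inj_on_subset by blast
  have "S \<inter> nxt n ` S = {}" using assms by (auto simp: cyclically_sparse_def)
  then have "sum f (covered n S) = sum f S + sum f (nxt n ` S)"
    unfolding covered_def using S by (intro sum.union_disjoint) auto
  then show ?thesis using inj by (simp add: sum.reindex sum.distrib)
qed

lemma card_covered:
  assumes "n \<ge> 2" "cyclically_sparse n S"
  shows "card (covered n S) = 2 * card S"
  using sum_covered[OF assms, of "\<lambda>_. 1::nat"] by simp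

lemma sum_odd_below_double: "(\<Sum>j<2 * m. if odd j then 1 else 0 :: int) = int m"
  by (induction m) auto

lemma z_weight_matching:
  assumes n: "n \<ge> 2" "even n" and c: "config n S D"
  shows "z_weight n (matching n S D) = int (n div 2) - int (card S + card D)"
proof -
  have sp: "cyclically_sparse n S" and D: "D \<subseteq> {..<n}" and S: "S \<subseteq> {..<n}"
    using c by (auto simp: config_def cyclically_sparse_def)
  have cov: "covered n S \<subseteq> {..<n}" by (rule covered_subset[OF S])
  let ?o = "\<lambda>j. if odd j then 1 else 0 :: int"
  have odds: "(\<Sum>j<n. ?o j) = int (n div 2)"
    using sum_odd_below_double[of "n div 2"] n(2) by simp
  have "z_weight n (matching n S D) =
      (\<Sum>j<n. if Vert 1 j \<in> matching n S D then if black (1, j) then 1 else - 1 else 0)"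
    unfolding z_weight_def by (intro sum.mono_neutral_cong_left) auto
  \<comment> \<open>An uncovered odd column has its black node in row 1 and contributes 1 unless it
    is in \<open>D\<close>; an uncovered even one contributes -1 exactly when it is in
    \<open>D\<close>. Covered columns contribute 0, so their indicator is subtracted again.\<close>
  also have "\<dots> = (\<Sum>j<n. ?o j - (if j \<in> D then 1 else 0) - (if j \<in> covered n S then ?o j else 0))"
    using c by (intro sum.cong) (auto simp: black_def config_def)
  also have "\<dots> = int (n div 2) - int (card D) - sum ?o (covered n S)"
    using D cov n by (simp add: sum_subtractf odds flip: sum.inter_restrict)
      (simp add: Int_absorb1)
  also have "sum ?o (covered n S) = (\<Sum>j\<in>S. 1)"
    unfolding sum_covered[OF n(1) sp]
  proof (rule sum.cong[OF refl])
    fix j assume "j \<in> S"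
    then have "j < n" using S by auto
    \<comment> \<open>Neighbouring columns differ in parity, also across the wrap from
      \<open>n - 1\<close> to 0 because \<open>n\<close> is even.\<close>
    then show "?o j + ?o (nxt n j) = 1" using n by (auto simp: nxt_eq)
  qed
  finally show ?thesis by simp
qed

lemma w_weight_matching: "w_weight n (matching n S D) = 0"
  by (simp add: w_weight_eq_0_iff)

section \<open>Sparse sets on a path and on a cycle\<close>

text \<open>The starting point \<open>a\<close> is left free since cutting the cycle produces paths
  starting at 0 and at 1.\<close>

definition linear_sparse_sets :: "nat \<Rightarrow> nat \<Rightarrow> nat \<Rightarrow> nat set set" where
  "linear_sparse_sets a m q = {S. S \<subseteq> {a..<a + m} \<and> (\<forall>j\<in>S. Suc j \<notin> S) \<and> card S = q}"

lemma finite_linear_sparse_sets: "finite (linear_sparse_sets a m q)"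
  by (rule finite_subset[of _ "Pow {a..<a + m}"]) (auto simp: linear_sparse_sets_def)

lemma card_insert_image:
  assumes "finite B" "x \<notin> \<Union>B"
  shows "card (insert x ` B) = card B"
proof (rule card_image)
  show "inj_on (insert x) B"
    using assms(2) by (intro inj_onI) (metis Diff_insert_absorb UnionI)
qed

text \<open>The last point \<open>a + m + 1\<close> of the longer path is either absent, or present
  and then excludes its predecessor. This leaves paths shorter by one and by two, whose counts add
  up by Pascal's rule.\<close>

lemma card_linear_sparse_sets: "card (linear_sparse_sets a m q) = (m + 1 - q) choose q"
proof (induction m arbitrary: q rule: induct_nat_012)
  case 0
  have "linear_sparse_sets a 0 q = (if q = 0 then {{}} else {})" by (auto simp: linear_sparse_sets_def)
  then show ?case by auto
next
  case 1
  have "linear_sparse_sets a 1 q = (if q = 0 then {{}} else if q = 1 then {{a}} else {})"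
    by (auto simp: linear_sparse_sets_def subset_singleton_iff)
  then show ?case by (auto)
next
  case (ge2 m)
  show ?case
  proof (cases q)
    case 0
    have "linear_sparse_sets a (Suc (Suc m)) 0 = {{}}"
      using finite_subset by (fastforce simp: linear_sparse_sets_def)
    then show ?thesis using 0 by simp
  next
    case (Suc k)
    have split: "linear_sparse_sets a (Suc (Suc m)) (Suc k) =
        linear_sparse_sets a (Suc m) (Suc k) \<union> insert (a + m + 1) ` linear_sparse_sets a m k" (is "?L = ?A \<union> ?B")
    proof (intro equalityI subsetI)
      fix S assume S: "S \<in> ?L"
      show "S \<in> ?A \<union> ?B"
      proof (cases "a + m + 1 \<in> S")
        case False
        then have "S \<subseteq> {a..<a + Suc m}" using S by (auto simp: linear_sparse_sets_def subset_iff less_Suc_eq)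
        then show ?thesis using S by (simp add: linear_sparse_sets_def)
      next
        case True
        then have "a + m \<notin> S" using S by (auto simp: linear_sparse_sets_def)
        then have "S - {a + m + 1} \<in> linear_sparse_sets a m k"
          using S True by (auto simp: linear_sparse_sets_def subset_iff less_Suc_eq)
        then show ?thesis using True by (metis UnI2 image_eqI insert_Diff)
      qed
    next
      fix S assume "S \<in> ?A \<union> ?B"
      then show "S \<in> ?L"
      proof
        assume "S \<in> ?B"
        then obtain T where T: "S = insert (a + m + 1) T" "T \<in> linear_sparse_sets a m k" by blast
        then have "finite T" "a + m + 1 \<notin> T" "a + m + 2 \<notin> T"
          by (auto simp: linear_sparse_sets_def intro: finite_subset)
        then show ?thesis using T by (auto simp: linear_sparse_sets_def subset_iff)
      qed (auto simp: linear_sparse_sets_def)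
    qed
    have "card ?L = card ?A + card ?B"
      unfolding split
      by (rule card_Un_disjoint) (auto simp: finite_linear_sparse_sets, auto simp: linear_sparse_sets_def)
    also have "card ?B = card (linear_sparse_sets a m k)"
      by (rule card_insert_image) (auto simp: finite_linear_sparse_sets, auto simp: linear_sparse_sets_def)
    also have "card ?A + card (linear_sparse_sets a m k) = (Suc m - k choose Suc k) + (Suc m - k choose k)"
      using ge2 by simp
    \<comment> \<open>For \<open>k\<close> above \<open>Suc m\<close> the truncated differences are
      0 and all three binomials vanish.\<close>
    also have "\<dots> = (Suc (Suc m) - k) choose Suc k"
      by (cases "k \<le> Suc m") (auto simp: Suc_diff_le)
    finally show ?thesis using Suc by simp
  qed
qed

definition cyclic_sparse_sets :: "nat \<Rightarrow> nat \<Rightarrow> nat set set" where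
  "cyclic_sparse_sets n q = {S. cyclically_sparse n S \<and> card S = q}"

lemma finite_cyclic_sparse_sets: "finite (cyclic_sparse_sets n q)"
  by (rule finite_subset[of _ "Pow {..<n}"]) (auto simp: cyclic_sparse_sets_def cyclically_sparse_def)

lemma cyclic_sparse_sets_0: "cyclic_sparse_sets n 0 = {{}}"
  by (auto simp: cyclic_sparse_sets_def cyclically_sparse_def dest: finite_subset)

text \<open>The cycle is cut at column \<open>n - 1\<close>. If it is absent, a sparse set on the
  path \<open>0, ..., n - 2\<close> remains; if present, both its neighbours are excluded and the
  other \<open>k\<close> elements lie on \<open>1, ..., n - 3\<close>.\<close>

lemma card_cyclic_sparse_sets_Suc:
  assumes "n \<ge> 2"
  shows "card (cyclic_sparse_sets n (Suc k)) = (n - Suc k choose Suc k) + (n - k - 2 choose k)"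
proof -
  obtain m where n: "n = Suc (Suc m)" using assms by (metis One_nat_def Suc_1 Suc_le_D Suc_le_mono)
  have split: "cyclic_sparse_sets n (Suc k) =
      linear_sparse_sets 0 (Suc m) (Suc k) \<union> insert (Suc m) ` linear_sparse_sets 1 (m - 1) k" (is "?L = ?A \<union> ?B")
  proof (intro equalityI subsetI)
    fix S assume S: "S \<in> ?L"
    then have sub: "S \<subseteq> {..<Suc (Suc m)}" and sp: "\<And>j. j \<in> S \<Longrightarrow> nxt n j \<notin> S" and c: "card S = Suc k"
      by (auto simp: cyclic_sparse_sets_def cyclically_sparse_def n)
    show "S \<in> ?A \<union> ?B"
    proof (cases "Suc m \<in> S")
      case False
      then have "S \<subseteq> {0..<Suc m}" using sub by (auto simp: subset_iff less_Suc_eq)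
      moreover have "Suc j \<notin> S" if "j \<in> S" for j
        using sp[OF that] that calculation n by (auto simp: nxt_eq subset_iff)
      ultimately show ?thesis using c by (simp add: linear_sparse_sets_def)
    next
      case True
      have "0 \<notin> S" using sp[OF True] by (simp add: n nxt_eq)
      moreover have "m \<notin> S" using sp[of m] True by (auto simp: n nxt_eq)
      moreover have "Suc j \<notin> S" if "j \<in> S" "j \<noteq> Suc m" for j
        using sp[of j] that sub by (auto simp: n nxt_eq subset_iff)
      moreover have "Suc 0 \<le> j \<and> j < Suc (m - Suc 0)" if "j \<in> S" "j \<noteq> Suc m" for j
      proof -
        have "j < Suc (Suc m)" "j \<noteq> 0" "j \<noteq> m"
          using that sub \<open>0 \<notin> S\<close> \<open>m \<notin> S\<close> by (auto intro!: gr0I)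
        then show ?thesis using that(2) by linarith
      qed
      ultimately have "S - {Suc m} \<in> linear_sparse_sets 1 (m - 1) k"
        using True c by (auto simp: linear_sparse_sets_def subset_iff)
      then show ?thesis using True by (metis UnI2 image_eqI insert_Diff)
    qed
  next
    fix S assume "S \<in> ?A \<union> ?B"
    then show "S \<in> ?L"
    proof
      assume "S \<in> ?A"
      then show ?thesis
        by (auto simp: linear_sparse_sets_def cyclic_sparse_sets_def cyclically_sparse_def n nxt_eq subset_iff)
    next
      assume "S \<in> ?B"
      then obtain T where T: "S = insert (Suc m) T" "T \<in> linear_sparse_sets 1 (m - 1) k" by blast
      have "finite T" using T(2) by (auto simp: linear_sparse_sets_def dest: finite_subset)
      with T(2) have T': "finite T" "Suc m \<notin> T" "\<And>j. j \<in> T \<Longrightarrow> 0 < j \<and> j < m" "\<And>j. j \<in> T \<Longrightarrow> Suc j \<notin> T"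
        by (auto simp: linear_sparse_sets_def subset_iff)
      have "card S = Suc k" using T T' by (simp add: linear_sparse_sets_def)
      moreover have "S \<subseteq> {..<n}" using T(1) T'(3) n by force
      moreover have "nxt n j \<notin> S" if "j \<in> S" for j
        using that T(1) T'(3)[of j] T'(3)[of 0] T'(4)[of j] by (auto simp: n nxt_eq)
      ultimately show ?thesis by (simp add: cyclic_sparse_sets_def cyclically_sparse_def)
    qed
  qed
  have "card ?L = card ?A + card ?B"
    unfolding split
    by (rule card_Un_disjoint) (auto simp: finite_linear_sparse_sets, auto simp: linear_sparse_sets_def)
  also have "card ?B = card (linear_sparse_sets 1 (m - 1) k)"
    by (rule card_insert_image) (auto simp: finite_linear_sparse_sets, auto simp: linear_sparse_sets_def)
  also have "card ?A + card (linear_sparse_sets 1 (m - 1) k) =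
      (n - Suc k choose Suc k) + (m - 1 + 1 - k choose k)"
    by (simp add: card_linear_sparse_sets n)
  \<comment> \<open>For \<open>m = 0\<close> truncation gives \<open>m - 1 + 1 = 1\<close> instead
    of 0, but the two binomials still agree for every \<open>k\<close>.\<close>
  also have "(m - 1 + 1 - k choose k) = (n - k - 2 choose k)"
    by (cases m; cases k) (auto simp: n)
  finally show ?thesis .
qed

text \<open>Over the common denominator \<open>fact q * fact (n - 2 * q)\<close>, the two binomials
  from cutting the cycle carry the factors \<open>n - q\<close> and \<open>q\<close>, which sum to
  \<open>n\<close>.\<close>

lemma card_cyclic_sparse_sets:
  assumes "n \<ge> 2"
  shows "real (card (cyclic_sparse_sets n q)) =
    (if n < 2 * q then 0 else real n * fact (n - q - 1) / (fact q * fact (n - 2 * q)))"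
proof (cases q)
  case 0
  then show ?thesis using assms fact_reduce[of n, where 'a = real] by (simp add: cyclic_sparse_sets_0)
next
  case (Suc k)
  show ?thesis
  proof (cases "n < 2 * q")
    case True
    then have "n - Suc k < Suc k" "n - k - 2 < k" using assms Suc by linarith+
    then show ?thesis using True assms Suc by (simp only: card_cyclic_sparse_sets_Suc binomial_eq_0) simp
  next
    case False
    then obtain m where n: "n = 2 * Suc k + m" using Suc by (metis le_Suc_ex not_less)
    have "real (Suc k + m choose Suc k) = fact (Suc k + m) / (fact (Suc k) * fact m)"
      using binomial_fact[of "Suc k" "Suc k + m", where 'a = real] by simp
    moreover have "real (k + m choose k) = fact (k + m) / (fact k * fact m)"
      by (simp add: binomial_fact)
    moreover have "n - Suc k = Suc k + m" "n - k - 2 = k + m" "n - 2 * Suc k = m" "n - Suc k - 1 = k + m"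
      using n by auto
    moreover have "fact (Suc k + m) / (fact (Suc k) * fact m) + fact (k + m) / (fact k * fact m)
       = real n * fact (k + m) / (fact (Suc k) * fact m)"
    proof -
      have "fact (k + m) / (fact k * fact m) = real (Suc k) * fact (k + m) / (fact (Suc k) * fact m)"
        by (simp del: of_nat_Suc)
      moreover have "fact (Suc k + m) = real (Suc k + m) * fact (k + m)"
        by simp
      moreover have "real n = real (Suc k + m) + real (Suc k)" using n by simp
      ultimately show ?thesis by (simp only: add_divide_distrib distrib_right)
    qed
    ultimately show ?thesis using False Suc assms by (simp add: card_cyclic_sparse_sets_Suc)
  qed
qed

section \<open>Counting configurations\<close>

definition configs :: "nat \<Rightarrow> nat \<Rightarrow> nat \<Rightarrow> (nat set \<times> nat set) set" where
  "configs n a b = {(S, D). config n S D \<and> card D = a \<and> card S = b}"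

lemma finite_configs: "finite (configs n a b)"
  by (rule finite_subset[of _ "Pow {..<n} \<times> Pow {..<n}"])
    (auto simp: configs_def config_def cyclically_sparse_def)

lemma card_configs:
  assumes "n \<ge> 2"
  shows "card (configs n a b) = card (cyclic_sparse_sets n b) * (n - 2 * b choose a)"
proof -
  have "configs n a b = (SIGMA S:cyclic_sparse_sets n b. {D. D \<subseteq> {..<n} - covered n S \<and> card D = a})"
    by (auto simp: configs_def config_def cyclic_sparse_sets_def)
  then have "card (configs n a b) =
      (\<Sum>S\<in>cyclic_sparse_sets n b. card {D. D \<subseteq> {..<n} - covered n S \<and> card D = a})"
    by (simp add: finite_cyclic_sparse_sets)
  also have "\<dots> = (\<Sum>S\<in>cyclic_sparse_sets n b. n - 2 * b choose a)"
  proof (rule sum.cong[OF refl])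
    fix S assume "S \<in> cyclic_sparse_sets n b"
    then have S: "cyclically_sparse n S" "card S = b" by (auto simp: cyclic_sparse_sets_def)
    then have cov: "covered n S \<subseteq> {..<n}" by (simp add: covered_subset cyclically_sparse_def)
    then have "card ({..<n} - covered n S) = n - 2 * b"
      using card_covered[OF assms S(1)] S(2)
      by (simp add: card_Diff_subset finite_subset[OF cov])
    then show "card {D. D \<subseteq> {..<n} - covered n S \<and> card D = a} = (n - 2 * b choose a)"
      by (simp add: n_subsets)
  qed
  finally show ?thesis by simp
qed

section \<open>Transfer to matchings and closed forms\<close>

lemma inj_on_matching: "inj_on (\<lambda>(S, D). matching n S D) {(S, D). config n S D}"
  by (rule inj_onI) (auto dest: matching_inject)

lemma card_matching_image:
  assumes "A \<subseteq> {(S, D). config n S D}"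
  shows "card ((\<lambda>(S, D). matching n S D) ` A) = card A"
  using card_image inj_on_matching inj_on_subset assms by blast

lemma num_obtained_eq:
  assumes "n \<ge> 2"
  shows "num_obtained n p q = card (configs n (p - q) q)"
proof -
  have "{M. perfect_matching n M \<and> obtained n (p - q) q M}
      = (\<lambda>(S, D). matching n S D) ` configs n (p - q) q"
    using obtained_matching[OF assms] matching_obtained[OF assms] perfect_matching_matching[OF assms]
    by (fastforce simp: configs_def image_iff)
  then show ?thesis
    unfolding num_obtained_def by (simp add: card_matching_image configs_def Collect_mono_iff)
qed

text \<open>The second weight component makes the matching a configuration, and the first then fixes
  \<open>card S + card D = p\<close>. Sorting by \<open>q = card S\<close> splits these pairs into
  disjoint classes.\<close>

lemma num_weight_eq:
  assumes "n \<ge> 2" "even n"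
  shows "num_weight n p = (\<Sum>q\<le>p. card (configs n (p - q) q))"
proof -
  let ?U = "\<Union>q\<le>p. configs n (p - q) q"
  have U: "(S, D) \<in> ?U \<longleftrightarrow> config n S D \<and> card S + card D = p" for S D
    by (auto simp: configs_def)
  have "{M. perfect_matching n M \<and> weight n M = (int (n div 2) - int p, 0)}
      = (\<lambda>(S, D). matching n S D) ` ?U" (is "?L = ?R")
  proof (intro equalityI subsetI)
    fix M assume M: "M \<in> ?L"
    then obtain S D where SD: "config n S D" "M = matching n S D"
      using perfect_matching_eq_matching[OF assms(1)] by (auto simp: weight_def)
    then have "card S + card D = p"
      using M z_weight_matching[OF assms SD(1)] by (simp add: weight_def)
    then have "(S, D) \<in> ?U" using U SD by blast
    then show "M \<in> ?R" using SD by (metis (no_types, lifting) case_prod_conv image_eqI)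
  next
    fix M assume "M \<in> ?R"
    then obtain S D where SD: "(S, D) \<in> ?U" "M = matching n S D" by auto
    then have "config n S D" "card S + card D = p" using U by blast+
    then show "M \<in> ?L"
      using SD(2) perfect_matching_matching z_weight_matching assms w_weight_matching
      by (simp add: weight_def)
  qed
  then have "num_weight n p = card ?U"
    unfolding num_weight_def by (simp add: card_matching_image configs_def UN_subset_iff Collect_mono_iff)
  also have "\<dots> = (\<Sum>q\<le>p. card (configs n (p - q) q))"
    by (rule card_UN_disjoint) (auto simp: finite_configs, auto simp: configs_def)
  finally show ?thesis .
qed

lemma card_configs_closed_form:
  assumes "n \<ge> 2" "q \<le> p" "p \<le> n"
  shows "real (card (configs n (p - q) q)) =
    (if q > n - p then 0
     else real n * fact (n - q - 1) / (fact q * fact (p - q) * fact (n - q - p)))"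
proof (cases "q > n - p")
  case True
  \<comment> \<open>Either there is no room for \<open>q\<close> dominoes, or too few columns remain
    for \<open>D\<close>. When \<open>p = q\<close> only the first alternative can hold, because
    \<open>n - 2 * q\<close> is truncated.\<close>
  then have "n < 2 * q \<or> n - 2 * q < p - q" using assms by linarith
  then show ?thesis using True by (auto simp: card_configs card_cyclic_sparse_sets assms)
next
  case False
  then have q: "2 * q \<le> n" "p - q \<le> n - 2 * q" "n - 2 * q - (p - q) = n - q - p"
    using assms by linarith+
  have "real (n - 2 * q choose (p - q)) = fact (n - 2 * q) / (fact (p - q) * fact (n - q - p))"
    using q by (simp add: binomial_fact)
  then show ?thesis using False q assms by (simp add: card_configs card_cyclic_sparse_sets)
qed

theorem mainTheorem3:
  fixes n :: nat
  assumes "even n" and "n \<ge> 2"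
  shows "(\<forall>p q. q \<le> p \<and> p \<le> n \<longrightarrow>
            real (num_obtained n p q) =
              (if q > n - p then 0
               else 1 / (fact q * fact (p - q)) * real n * (fact (n - q - 1) / fact (n - q - p))) \<and>
            real (num_obtained n p q) =
              (if q > n - p then 0
               else real n / real (n - q) * real (p choose q) * real ((n - q) choose p))) \<and>
         (\<forall>p. p \<le> n \<longrightarrow>
            real (num_weight n p) =
              (\<Sum>q = 0..p. if q > n - p then 0
                 else real n * fact (n - q - 1) / (fact q * fact (p - q) * fact (n - q - p))))"
proof (intro conjI allI impI; (elim conjE)?)
  fix p q assume pq: "q \<le> p" "p \<le> n"
  note closed = num_obtained_eq[OF assms(2), of p q] card_configs_closed_form[OF assms(2) pq]
  show "real (num_obtained n p q) =
      (if q > n - p then 0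
       else 1 / (fact q * fact (p - q)) * real n * (fact (n - q - 1) / fact (n - q - p)))"
    using closed by simp
  have "real n / real (n - q) * real (p choose q) * real ((n - q) choose p) =
      real n * fact (n - q - 1) / (fact q * fact (p - q) * fact (n - q - p))" if "\<not> q > n - p"
  proof -
    \<comment> \<open>From \<open>q \<le> p\<close> and \<open>q \<le> n - p\<close> follows
      \<open>2 * q \<le> n\<close>, hence \<open>q < n\<close>: the division by \<open>n - q\<close>
      is genuine and not the default value 0.\<close>
    have "n - q > 0" "p \<le> n - q" using that pq assms(2) by linarith+
    then have "fact (n - q) = real (n - q) * fact (n - q - 1)"
      using fact_reduce[of "n - q", where 'a = real] by simp
    then show ?thesis
      using \<open>n - q > 0\<close> \<open>p \<le> n - q\<close> pq by (simp add: binomial_fact field_simps del: of_nat_diff)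
  qed
  then show "real (num_obtained n p q) =
      (if q > n - p then 0
       else real n / real (n - q) * real (p choose q) * real ((n - q) choose p))"
    using closed by simp
next
  fix p assume "p \<le> n"
  then show "real (num_weight n p) =
      (\<Sum>q = 0..p. if q > n - p then 0
         else real n * fact (n - q - 1) / (fact q * fact (p - q) * fact (n - q - p)))"
    unfolding num_weight_eq[OF assms(2,1)] of_nat_sum atMost_atLeast0
    by (intro sum.cong refl card_configs_closed_form assms(2)) auto
qed

end
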